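(* Let $k\ge 2$, let $G$ be an equitably $k$-colorable graph on $n$ vertices, and let $H$ be a $(k-1)$-partite graph. If $k$ divides $n$, then for every integer $l\ge 1$, $\chi_{=}(G\circ^l H)\le k$.
   Context: All graphs are finite, simple and connected. A graph is $r$-partite if its vertex set can be partitioned into $r$ independent sets. A graph is equitably $k$-colorable if its vertex set can be partitioned into $k$ (possibly empty) independent sets $V_1,\dots,V_k$ with $||V_i|-|V_j||\le 1$ for all $i,j$; $\chi_{=}(G)$ is the least $k$ for which $G$ is equitably $k$-colorable. The corona $G\circ H$ is formed from one copy of $G$ and $|V(G)|$ copies of $H$, the $i$-th vertex of $G$ being joined to every vertex of the $i$-th copy of $H$; $G\circ^1 H=G\circ H$ and $G\circ^l H=(G\circ^{l-1}H)\circ H$ for $l\ge 2$. *)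

theory Defs
  imports "Graph_Theory.Graph_Theory" "HOL-Library.Disjoint_Sets"
begin

text \<open>Finite simple graphs are \<open>pair_graph\<close>s: finite, loop-free digraphs without parallel arcs
  whose arc relation is symmetric. The library's \<open>connected\<close> excludes the null graph.\<close>

definition independent_set :: "'a pair_pre_digraph \<Rightarrow> 'a set \<Rightarrow> bool" where
  "independent_set G S \<longleftrightarrow> S \<subseteq> pverts G \<and> (\<forall>u\<in>S. \<forall>v\<in>S. (u, v) \<notin> parcs G)"

text \<open>The classes \<open>V 0, \<dots>, V (r - 1)\<close> may be empty.\<close>

definition independent_partition :: "'a pair_pre_digraph \<Rightarrow> nat \<Rightarrow> (nat \<Rightarrow> 'a set) \<Rightarrow> bool" where
  "independent_partition G r V \<longleftrightarrow>
     (\<Union>i<r. V i) = pverts G \<and> disjoint_family_on V {..<r} \<and> (\<forall>i<r. independent_set G (V i))"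

definition partite :: "nat \<Rightarrow> 'a pair_pre_digraph \<Rightarrow> bool" where
  "partite r G \<longleftrightarrow> (\<exists>V. independent_partition G r V)"

definition equitably_colorable :: "nat \<Rightarrow> 'a pair_pre_digraph \<Rightarrow> bool" where
  "equitably_colorable k G \<longleftrightarrow>
     (\<exists>V. independent_partition G k V \<and>
          (\<forall>i<k. \<forall>j<k. \<bar>int (card (V i)) - int (card (V j))\<bar> \<le> 1))"

definition equitable_chromatic_number :: "'a pair_pre_digraph \<Rightarrow> nat" where
  "equitable_chromatic_number G = (LEAST k. equitably_colorable k G)"

text \<open>\<open>Inl v\<close> is the vertex \<open>v\<close> of \<open>G\<close>; \<open>Inr (v, h)\<close> is the vertex \<open>h\<close> of the copy of \<open>H\<close>
  attached to \<open>v\<close>.\<close>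

definition corona ::
  "'a pair_pre_digraph \<Rightarrow> 'b pair_pre_digraph \<Rightarrow> ('a + 'a \<times> 'b) pair_pre_digraph" where
  "corona G H =
     \<lparr> pverts = Inl ` pverts G \<union> Inr ` (pverts G \<times> pverts H),
       parcs = {(Inl u, Inl v) | u v. (u, v) \<in> parcs G}
             \<union> {(Inr (v, h), Inr (v, h')) | v h h'. v \<in> pverts G \<and> (h, h') \<in> parcs H}
             \<union> {(Inl v, Inr (v, h)) | v h. v \<in> pverts G \<and> h \<in> pverts H}
             \<union> {(Inr (v, h), Inl v) | v h. v \<in> pverts G \<and> h \<in> pverts H} \<rparr>"

definition relabel :: "('a \<Rightarrow> 'b) \<Rightarrow> 'a pair_pre_digraph \<Rightarrow> 'b pair_pre_digraph" where
  "relabel f G = \<lparr> pverts = f ` pverts G, parcs = map_prod f f ` parcs G \<rparr>"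

text \<open>The vertex type of the corona grows with each iteration, so the iterated corona is relabelled
  injectively into one type: \<open>(v, xs)\<close> stems from the vertex \<open>v\<close> of \<open>G\<close>, and \<open>xs\<close> records,
  latest step first, whether that step kept the vertex reached so far (\<open>None\<close>) or moved to the vertex
  \<open>h\<close> of the copy of \<open>H\<close> attached to it (\<open>Some h\<close>).\<close>

fun corona_label :: "('a \<times> 'b option list) + ('a \<times> 'b option list) \<times> 'b \<Rightarrow> 'a \<times> 'b option list"
where
  "corona_label (Inl (v, xs)) = (v, None # xs)"
| "corona_label (Inr ((v, xs), h)) = (v, Some h # xs)"

primrec iterated_corona ::
  "'a pair_pre_digraph \<Rightarrow> nat \<Rightarrow> 'b pair_pre_digraph \<Rightarrow> ('a \<times> 'b option list) pair_pre_digraph"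
where
  "iterated_corona G 0 H = relabel (\<lambda>v. (v, [])) G"
| "iterated_corona G (Suc l) H = relabel corona_label (corona (iterated_corona G l H) H)"

lemma inj_corona_label: "inj corona_label"
proof (rule injI)
  fix x y :: "('a \<times> 'b option list) + ('a \<times> 'b option list) \<times> 'b"
  assume "corona_label x = corona_label y"
  then show "x = y"
    by (cases x rule: corona_label.cases; cases y rule: corona_label.cases) auto
qed

lemma pair_graph_corona:
  assumes "pair_graph G" "pair_graph H"
  shows "pair_graph (corona G H)"
proof -
  interpret G: pair_graph G by fact
  interpret H: pair_graph H by fact
  have sG: "(v, u) \<in> parcs G" if "(u, v) \<in> parcs G" for u v
    using G.pair_sym_arcs that by (auto simp: symmetric_def dest: symD)
  have sH: "(v, u) \<in> parcs H" if "(u, v) \<in> parcs H" for u v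
    using H.pair_sym_arcs that by (auto simp: symmetric_def dest: symD)
  have wf: "parcs (corona G H) \<subseteq> pverts (corona G H) \<times> pverts (corona G H)"
    by (auto simp: corona_def dest: G.wellformed' H.wellformed')
  have fin: "finite (pverts (corona G H))"
    by (auto simp: corona_def G.pair_finite_verts H.pair_finite_verts)
  show ?thesis
  proof
    show "finite (parcs (corona G H))"
      using finite_subset[OF wf] fin by blast
    show "symmetric (with_proj (corona G H))"
      unfolding symmetric_def by (rule symI) (auto simp: corona_def sG sH)
    show "fst e \<noteq> snd e" if "e \<in> parcs (corona G H)" for e
      using that by (auto simp: corona_def dest: G.pair_no_loops H.pair_no_loops)
  qed (use wf fin in auto)
qed

lemma pair_graph_relabel:
  assumes "pair_graph G" "inj f"
  shows "pair_graph (relabel f G)"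
proof -
  interpret G: pair_graph G by fact
  have sG: "(v, u) \<in> parcs G" if "(u, v) \<in> parcs G" for u v
    using G.pair_sym_arcs that by (auto simp: symmetric_def dest: symD)
  show ?thesis
  proof
    show "symmetric (with_proj (relabel f G))"
      unfolding symmetric_def by (rule symI) (force simp: relabel_def dest: sG)
    show "fst e \<noteq> snd e" if "e \<in> parcs (relabel f G)" for e
      using that G.pair_no_loops injD[OF \<open>inj f\<close>] by (fastforce simp: relabel_def)
  qed (auto simp: relabel_def G.pair_finite_verts G.pair_finite_arcs dest: G.wellformed')
qed

lemma pair_graph_iterated_corona:
  assumes "pair_graph G" "pair_graph H"
  shows "pair_graph (iterated_corona G l H)"
  by (induction l)
     (auto intro!: pair_graph_relabel pair_graph_corona assms inj_corona_label injI)

text \<open>Singleton classes give an equitable coloring, so the \<open>LEAST\<close> above is attained.\<close>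

lemma equitably_colorable_card:
  assumes "pair_graph G"
  shows "equitably_colorable (card (pverts G)) G"
proof -
  interpret G: pair_graph G by fact
  obtain f where f: "bij_betw f {..<card (pverts G)} (pverts G)"
    using ex_bij_betw_nat_finite[OF G.pair_finite_verts] by (auto simp: atLeast0LessThan)
  have "independent_partition G (card (pverts G)) (\<lambda>i. {f i})"
    using f G.pair_no_loops
    by (fastforce simp: independent_partition_def independent_set_def disjoint_family_on_def
        bij_betw_def inj_on_def)
  then show ?thesis
    unfolding equitably_colorable_def by (intro exI[of _ "\<lambda>i. {f i}"]) simp
qed

end

theory Submission
  imports Defs "HOL-Number_Theory.Cong"
begin

text \<open>An equitable \<open>k\<close>-coloring of a graph whose order is a multiple of \<open>k\<close> has classes of one common
  size \<open>m\<close>. Color the copy of \<open>H\<close> at \<open>v\<close> by shifting a fixed \<open>(k - 1)\<close>-coloring \<open>d\<close> of \<open>H\<close> cyclically: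
  \<open>h\<close> receives \<open>c v + 1 + d h\<close> modulo \<open>k\<close>, which avoids \<open>c v\<close>. For fixed \<open>h\<close> this is a cyclic
  shift of \<open>c\<close>, so the vertices \<open>h\<close> of all copies together add exactly \<open>m\<close> vertices to each class.
  Hence the corona has classes of common size \<open>m (1 + |H|)\<close>, and the step can be iterated.\<close>

definition color_class :: "'a pair_pre_digraph \<Rightarrow> ('a \<Rightarrow> nat) \<Rightarrow> nat \<Rightarrow> 'a set" where
  "color_class G c i = {v \<in> pverts G. c v = i}"

definition proper_coloring :: "nat \<Rightarrow> 'a pair_pre_digraph \<Rightarrow> ('a \<Rightarrow> nat) \<Rightarrow> bool" where
  "proper_coloring k G c \<longleftrightarrow>
     (\<forall>v\<in>pverts G. c v < k) \<and> (\<forall>(u, v)\<in>parcs G. c u \<noteq> c v)"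

definition balanced_coloring :: "nat \<Rightarrow> nat \<Rightarrow> 'a pair_pre_digraph \<Rightarrow> ('a \<Rightarrow> nat) \<Rightarrow> bool" where
  "balanced_coloring k m G c \<longleftrightarrow>
     proper_coloring k G c \<and> (\<forall>i<k. card (color_class G c i) = m)"

lemma independent_partition_color_class:
  assumes "proper_coloring k G c"
  shows "independent_partition G k (color_class G c)"
  using assms
  by (fastforce simp: independent_partition_def independent_set_def disjoint_family_on_def
      proper_coloring_def color_class_def)

lemma equitably_colorable_of_balanced_coloring:
  assumes "balanced_coloring k m G c"
  shows "equitably_colorable k G"
  unfolding equitably_colorable_def
  using assms independent_partition_color_class
  by (intro exI[of _ "color_class G c"]) (auto simp: balanced_coloring_def)

lemma disjoint_family_on_index:
  assumes "disjoint_family_on V I"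
  obtains c where "\<And>i v. i \<in> I \<Longrightarrow> v \<in> V i \<Longrightarrow> c v = i"
proof
  show "(THE j. j \<in> I \<and> v \<in> V j) = i" if "i \<in> I" "v \<in> V i" for i v
    using that disjoint_family_onD[OF assms] by (intro the_equality) blast+
qed

lemma proper_coloring_of_independent_partition:
  assumes "pair_wf_digraph G" "independent_partition G k V"
  obtains c where "proper_coloring k G c" "\<And>i. i < k \<Longrightarrow> color_class G c i = V i"
proof -
  interpret pair_wf_digraph G by fact
  have cover: "pverts G = (\<Union>i<k. V i)" and disjoint: "disjoint_family_on V {..<k}"
    and independent: "\<And>i u v. i < k \<Longrightarrow> u \<in> V i \<Longrightarrow> v \<in> V i \<Longrightarrow> (u, v) \<notin> parcs G"
    using assms(2) by (auto simp: independent_partition_def independent_set_def)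
  obtain c where index: "\<And>i v. i < k \<Longrightarrow> v \<in> V i \<Longrightarrow> c v = i"
    using disjoint_family_on_index[OF disjoint] by (metis lessThan_iff)
  have bounded: "c v < k" and in_class: "v \<in> V (c v)" if "v \<in> pverts G" for v
    using that index by (auto simp: cover)
  have "c u \<noteq> c v" if "(u, v) \<in> parcs G" for u v
    using that wellformed'[OF that] bounded in_class independent by metis
  then have "proper_coloring k G c"
    using bounded by (auto simp: proper_coloring_def)
  moreover have "color_class G c i = V i" if "i < k" for i
    using that in_class index by (auto simp: color_class_def cover)
  ultimately show thesis
    by (rule that)
qed

lemma nearly_constant_sum_eq_imp_constant:
  fixes f :: "'i \<Rightarrow> nat"
  assumes "finite I" and sum: "sum f I = card I * q"
    and close: "\<And>i j. i \<in> I \<Longrightarrow> j \<in> I \<Longrightarrow> f i \<le> Suc (f j)"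
    and "i \<in> I"
  shows "f i = q"
proof -
  have sum_const: "sum f I = (\<Sum>j\<in>I. q)"
    using sum by simp
  show ?thesis
  proof (cases "\<exists>j\<in>I. q < f j")
    case True
    then have "q \<le> f j" if "j \<in> I" for j
      using close that by fastforce
    then show ?thesis
      using sum_mono_inv[OF sum_const[symmetric]] assms(1,4) by auto
  next
    case False
    then have "f j \<le> q" if "j \<in> I" for j
      using that by (simp add: not_less)
    then show ?thesis
      using sum_mono_inv[OF sum_const] assms(1,4) by auto
  qed
qed

lemma balanced_coloring_of_equitably_colorable:
  assumes "pair_fin_digraph G" "equitably_colorable k G" "card (pverts G) = k * m"
  obtains c where "balanced_coloring k m G c"
proof -
  interpret pair_fin_digraph G by fact
  obtain V where V: "independent_partition G k V"
    and equitable: "\<forall>i<k. \<forall>j<k. \<bar>int (card (V i)) - int (card (V j))\<bar> \<le> 1"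
    using assms(2) unfolding equitably_colorable_def by blast
  have cover: "(\<Union>i<k. V i) = pverts G" and disjoint: "disjoint_family_on V {..<k}"
    using V by (auto simp: independent_partition_def)
  have "finite (\<Union>i<k. V i)"
    by (simp only: cover pair_finite_verts)
  then have sum: "(\<Sum>i<k. card (V i)) = card {..<k} * m"
    using card_UN_disjoint'[OF disjoint] assms(3) by (simp flip: cover)
  have close: "card (V i) \<le> Suc (card (V j))" if "i < k" "j < k" for i j
    using equitable[rule_format, OF that] by linarith
  have "card (V i) = m" if "i < k" for i
    using nearly_constant_sum_eq_imp_constant[OF finite_lessThan sum] close that by simp
  moreover obtain c where "proper_coloring k G c" "\<And>i. i < k \<Longrightarrow> color_class G c i = V i"
    using proper_coloring_of_independent_partition[OF pair_wf_digraph_axioms V] by blast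
  ultimately have "balanced_coloring k m G c"
    by (simp add: balanced_coloring_def)
  then show thesis
    by (rule that)
qed

lemma proper_coloring_relabel:
  "proper_coloring k (relabel f G) c \<longleftrightarrow> proper_coloring k G (c \<circ> f)"
  by (auto simp: proper_coloring_def relabel_def)

lemma color_class_relabel:
  "color_class (relabel f G) c i = f ` color_class G (c \<circ> f) i"
  by (auto simp: color_class_def relabel_def)

lemma balanced_coloring_relabel:
  assumes "inj_on f (pverts G)"
  shows "balanced_coloring k m (relabel f G) c \<longleftrightarrow> balanced_coloring k m G (c \<circ> f)"
proof -
  have "card (color_class (relabel f G) c i) = card (color_class G (c \<circ> f) i)" for i
    unfolding color_class_relabel
    by (rule card_image, rule inj_on_subset[OF assms]) (auto simp: color_class_def)
  then show ?thesis
    by (simp add: balanced_coloring_def proper_coloring_relabel)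
qed

lemma balanced_coloring_permute_colors:
  assumes "pair_wf_digraph G"
    and p: "bij_betw p {..<k} {..<k}" and c: "balanced_coloring k m G c"
  shows "balanced_coloring k m G (p \<circ> c)"
proof -
  interpret pair_wf_digraph G by fact
  have c_bound: "c v < k" if "v \<in> pverts G" for v
    using c that by (simp add: balanced_coloring_def proper_coloring_def)
  have p_eq_iff: "p a = p b \<longleftrightarrow> a = b" if "a < k" "b < k" for a b
    using bij_betw_imp_inj_on[OF p] that by (simp add: inj_on_eq_iff)
  have "p (c v) < k" if "v \<in> pverts G" for v
    using bij_betwE[OF p] c_bound[OF that] by simp
  moreover have "p (c u) \<noteq> p (c v)" if "(u, v) \<in> parcs G" for u v
  proof -
    have "c u \<noteq> c v"
      using c that by (auto simp: balanced_coloring_def proper_coloring_def)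
    then show ?thesis
      using wellformed'[OF that] by (simp add: p_eq_iff c_bound)
  qed
  moreover have "card (color_class G (p \<circ> c) i) = m" if "i < k" for i
  proof -
    have "i \<in> p ` {..<k}"
      using bij_betw_imp_surj_on[OF p] that by simp
    then obtain j where j: "j < k" "i = p j"
      by auto
    then have "color_class G (p \<circ> c) i = color_class G c j"
      using c_bound by (auto simp: color_class_def p_eq_iff)
    then show ?thesis
      using c j by (simp add: balanced_coloring_def)
  qed
  ultimately show ?thesis
    by (auto simp: balanced_coloring_def proper_coloring_def)
qed

definition cyclic_shift :: "nat \<Rightarrow> nat \<Rightarrow> nat \<Rightarrow> nat" where
  "cyclic_shift k s a = (a + s) mod k"

lemma bij_betw_cyclic_shift: "bij_betw (cyclic_shift k s) {..<k} {..<k}"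
proof -
  have "inj_on (cyclic_shift k s) {..<k}"
  proof (rule inj_onI)
    fix a b assume "a \<in> {..<k}" "b \<in> {..<k}" "cyclic_shift k s a = cyclic_shift k s b"
    then have "[a = b] (mod k)" "a < k" "b < k"
      using cong_add_rcancel_nat[of a s b k] by (simp_all add: cyclic_shift_def cong_def)
    then show "a = b"
      by (rule cong_less_modulus_unique_nat)
  qed
  moreover have "cyclic_shift k s ` {..<k} \<subseteq> {..<k}"
    by (auto simp: cyclic_shift_def)
  ultimately show ?thesis
    by (simp add: bij_betw_def endo_inj_surj)
qed

lemma cyclic_shift_eq_iff:
  assumes "s < k" "t < k"
  shows "cyclic_shift k s a = cyclic_shift k t a \<longleftrightarrow> s = t"
  using cong_add_lcancel_nat[of a s t k] assms by (simp add: cyclic_shift_def cong_def)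

lemma cyclic_shift_eq_self_iff:
  assumes "a < k" "s < k"
  shows "cyclic_shift k s a = a \<longleftrightarrow> s = 0"
  using cyclic_shift_eq_iff[of s k 0 a] assms by (simp add: cyclic_shift_def)

fun corona_coloring :: "nat \<Rightarrow> ('a \<Rightarrow> nat) \<Rightarrow> ('b \<Rightarrow> nat) \<Rightarrow> 'a + 'a \<times> 'b \<Rightarrow> nat" where
  "corona_coloring k c d (Inl v) = c v"
| "corona_coloring k c d (Inr (v, h)) = cyclic_shift k (Suc (d h)) (c v)"

lemma proper_coloring_corona:
  assumes "pair_wf_digraph H" "proper_coloring k G c" "proper_coloring (k - 1) H d"
  shows "proper_coloring k (corona G H) (corona_coloring k c d)"
proof -
  interpret H: pair_wf_digraph H by fact
  have c_bound: "c v < k" if "v \<in> pverts G" for v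
    using assms(2) that by (simp add: proper_coloring_def)
  have c_proper: "c u \<noteq> c v" if "(u, v) \<in> parcs G" for u v
    using assms(2) that by (auto simp: proper_coloring_def)
  have d_bound: "Suc (d h) < k" if "h \<in> pverts H" for h
    using assms(3) that by (fastforce simp: proper_coloring_def)
  have shift_bound: "cyclic_shift k (Suc (d h)) (c v) < k" if "v \<in> pverts G" for v h
    using c_bound[OF that] by (simp add: cyclic_shift_def)
  have shift_neq: "cyclic_shift k (Suc (d h)) (c v) \<noteq> c v"
    if "v \<in> pverts G" "h \<in> pverts H" for v h
    using cyclic_shift_eq_self_iff[OF c_bound d_bound] that by blast
  have copy_proper: "cyclic_shift k (Suc (d h)) a \<noteq> cyclic_shift k (Suc (d h')) a"
    if "(h, h') \<in> parcs H" for h h' a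
    using assms(3) that d_bound H.wellformed'[OF that]
    by (auto simp: cyclic_shift_eq_iff proper_coloring_def)
  show ?thesis
    using c_bound c_proper shift_bound shift_neq shift_neq[symmetric] copy_proper
    by (auto simp: proper_coloring_def corona_def)
qed

lemma color_class_corona_coloring:
  "color_class (corona G H) (corona_coloring k c d) i =
     color_class G c i <+>
     prod.swap ` (SIGMA h:pverts H. color_class G (cyclic_shift k (Suc (d h)) \<circ> c) i)"
  by (force simp: color_class_def corona_def)

lemma balanced_coloring_corona:
  assumes "pair_fin_digraph G" "pair_fin_digraph H"
    and c: "balanced_coloring k m G c" and d: "proper_coloring (k - 1) H d"
  shows "balanced_coloring k (m * Suc (card (pverts H))) (corona G H) (corona_coloring k c d)"
proof -
  interpret G: pair_fin_digraph G by fact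
  interpret H: pair_fin_digraph H by fact
  have finite_class: "finite (color_class G c' i)" for c' i
    by (simp add: color_class_def)
  have "card (color_class (corona G H) (corona_coloring k c d) i) = m * Suc (card (pverts H))"
    if "i < k" for i
  proof -
    let ?C = "\<lambda>h. color_class G (cyclic_shift k (Suc (d h)) \<circ> c) i"
    have card_shifted: "card (?C h) = m" for h
      using balanced_coloring_permute_colors[OF G.pair_wf_digraph_axioms bij_betw_cyclic_shift c] that
      by (simp add: balanced_coloring_def)
    have "card (color_class (corona G H) (corona_coloring k c d) i) =
        card (color_class G c i) + card (SIGMA h:pverts H. ?C h)"
      by (simp add: color_class_corona_coloring card_Plus card_image finite_class)
    also have "\<dots> = m + (\<Sum>h\<in>pverts H. card (?C h))"
      using c that by (simp add: balanced_coloring_def finite_class)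
    also have "\<dots> = m * Suc (card (pverts H))"
      by (simp add: card_shifted)
    finally show ?thesis .
  qed
  moreover have "proper_coloring k (corona G H) (corona_coloring k c d)"
    using H.pair_wf_digraph_axioms c d
    by (intro proper_coloring_corona) (simp_all add: balanced_coloring_def)
  ultimately show ?thesis
    by (simp add: balanced_coloring_def)
qed

lemma balanced_coloring_iterated_corona:
  assumes "pair_graph G" "pair_graph H"
    and "balanced_coloring k m G c" "proper_coloring (k - 1) H d"
  shows "\<exists>c'. balanced_coloring k (m * Suc (card (pverts H)) ^ l) (iterated_corona G l H) c'"
proof (induction l)
  case 0
  have "balanced_coloring k m (iterated_corona G 0 H) (c \<circ> fst)"
    using assms(3) by (simp add: balanced_coloring_relabel inj_on_def comp_def)
  then show ?case
    by auto
next
  case (Suc l)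
  let ?G = "iterated_corona G l H" and ?m = "m * Suc (card (pverts H)) ^ l"
  interpret G: pair_graph ?G
    using assms(1,2) by (rule pair_graph_iterated_corona)
  interpret H: pair_graph H by fact
  obtain c' where "balanced_coloring k ?m ?G c'"
    using Suc by blast
  then have "balanced_coloring k (?m * Suc (card (pverts H))) (corona ?G H) (corona_coloring k c' d)"
    using G.pair_fin_digraph_axioms H.pair_fin_digraph_axioms assms(4)
    by (intro balanced_coloring_corona)
  then have "balanced_coloring k (?m * Suc (card (pverts H))) (iterated_corona G (Suc l) H)
      (corona_coloring k c' d \<circ> inv corona_label)"
    by (simp add: balanced_coloring_relabel inj_on_subset[OF inj_corona_label] comp_assoc
        inj_corona_label)
  then show ?case
    unfolding power_Suc2 mult.assoc by blast
qed

theorem theorem1: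
  fixes G :: "'a pair_pre_digraph" and H :: "'b pair_pre_digraph" and k n l :: nat
  assumes "k \<ge> 2"
    and "pair_graph G" and "Digraph_Component.connected (with_proj G)"
    and "pair_graph H" and "Digraph_Component.connected (with_proj H)"
    and "equitably_colorable k G" and "card (pverts G) = n"
    and "partite (k - 1) H"
    and "k dvd n"
    and "l \<ge> 1"
  shows "equitable_chromatic_number (iterated_corona G l H) \<le> k"
proof -
  interpret G: pair_graph G by fact
  interpret H: pair_graph H by fact
  obtain m where "card (pverts G) = k * m"
    using assms(7,9) by (auto elim: dvdE)
  then obtain c where c: "balanced_coloring k m G c"
    using balanced_coloring_of_equitably_colorable[OF G.pair_fin_digraph_axioms assms(6)] by blast
  obtain d where d: "proper_coloring (k - 1) H d"
    using proper_coloring_of_independent_partition[OF H.pair_wf_digraph_axioms] assms(8)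
    unfolding partite_def by blast
  have "equitably_colorable k (iterated_corona G l H)"
    using balanced_coloring_iterated_corona[OF assms(2,4) c d]
      equitably_colorable_of_balanced_coloring by blast
  then show ?thesis
    unfolding equitable_chromatic_number_def by (rule Least_le)
qed

end
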